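(* Let $\sigma\in\{1,-1\}$, let $a=\mathrm{diag}(i,-i)$, and for a smooth function $q:\mathbb{R}^2\to\mathbb{C}$ of $(x,t)$ let $$u=\begin{pmatrix}0&q\\-\bar q&0\end{pmatrix},\qquad Q_{-1}=\frac i2\begin{pmatrix}-|q|^2&q_x\\ \bar q_x&|q|^2\end{pmatrix}.$$ (1) The equation $(\mathrm{GP}^{\pm})$ (with $\sigma=\pm1$) $$q_t=\frac i2\left(q_{xx}+\sigma q+2|q|^2q\right)$$ has the Lax pair $$\tau=(a\lambda+u)\,dx+\left(a\lambda^2+u\lambda+Q_{-1}-\frac\sigma4a\right)dt.$$ (2) If $q$ solves $(\mathrm{GP}^\pm)$ and $v=e^{-\sigma\frac i2t}q$, then $\tau$ is gauge equivalent to the Lax pair $\theta_2$ of the focusing NLS associated with $v$. (3) If $v$ is a solution of the focusing NLS $v_t=\frac i2(v_{xx}+2|v|^2v)$, then $$q=e^{\sigma\frac i2t}v$$ is a solution of $(\mathrm{GP}^\pm)$.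
   Context: A matrix-valued one-form $\tau=A\,dx+B\,dt$ depending on a parameter $\lambda\in\mathbb{C}$ is a Lax pair of an equation for $q$ if $q$ solves the equation if and only if $\tau$ is flat for every $\lambda\in\mathbb{C}$, i.e. $A_t-B_x=[A,B]$ (the integrability condition of $E^{-1}dE=\tau$). The Lax pair of the focusing NLS associated with $v$ is $$\theta_2=(a\lambda+u_v)\,dx+\left(a\lambda^2+u_v\lambda+Q_{-1}(v)\right)dt,$$ with $u_v=\begin{pmatrix}0&v\\-\bar v&0\end{pmatrix}$ and $Q_{-1}(v)=\frac i2\begin{pmatrix}-|v|^2&v_x\\ \bar v_x&|v|^2\end{pmatrix}$. Two such one-forms $\tau,\theta$ are gauge equivalent if there is a smooth $g:\mathbb{R}^2\to SU(2)$, independent of $\lambda$, such that $\tau=g\theta g^{-1}-(dg)g^{-1}$ for all $\lambda$. *)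

theory Defs
  imports "HOL-Analysis.Analysis"
begin

text \<open>Points of the plane are pairs \<open>(x, t)\<close>.\<close>

type_synonym plane = "real \<times> real"
type_synonym cmat2 = "complex^2^2"

text \<open>A function on a Euclidean space is \<open>C\<^sup>n\<^sup>+\<^sup>1\<close> iff it is differentiable and all its directional
  derivatives are \<open>C\<^sup>n\<close>.\<close>

primrec Ck :: "nat \<Rightarrow> ('a::euclidean_space \<Rightarrow> 'b::real_normed_vector) \<Rightarrow> bool" where
  "Ck 0 f \<longleftrightarrow> continuous_on UNIV f"
| "Ck (Suc n) f \<longleftrightarrow> (\<forall>p. f differentiable (at p)) \<and>
     (\<forall>h. Ck n (\<lambda>p. frechet_derivative f (at p) h))"

definition smooth :: "('a::euclidean_space \<Rightarrow> 'b::real_normed_vector) \<Rightarrow> bool" where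
  "smooth f \<longleftrightarrow> (\<forall>n. Ck n f)"

definition dx :: "(plane \<Rightarrow> 'b::real_normed_vector) \<Rightarrow> plane \<Rightarrow> 'b" where
  "dx f = (\<lambda>(x, t). vector_derivative (\<lambda>s. f (s, t)) (at x))"

definition dt :: "(plane \<Rightarrow> 'b::real_normed_vector) \<Rightarrow> plane \<Rightarrow> 'b" where
  "dt f = (\<lambda>(x, t). vector_derivative (\<lambda>s. f (x, s)) (at t))"

definition mat22 :: "complex \<Rightarrow> complex \<Rightarrow> complex \<Rightarrow> complex \<Rightarrow> cmat2" where
  "mat22 p q r s = vector [vector [p, q], vector [r, s]]"

definition cscale :: "complex \<Rightarrow> cmat2 \<Rightarrow> cmat2" (infixr "*\<^sub>C" 75) where
  "c *\<^sub>C M = map_matrix (\<lambda>z. c * z) M"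

definition commutator :: "cmat2 \<Rightarrow> cmat2 \<Rightarrow> cmat2" where
  "commutator A B = A ** B - B ** A"

definition SU2 :: "cmat2 set" where
  "SU2 = {M. M ** map_matrix cnj (transpose M) = mat 1 \<and> det M = 1}"

text \<open>The pair \<open>(A, B)\<close> encodes the one-form \<open>A dx + B dt\<close>. The differentiability of \<open>A\<close> and \<open>B\<close>
  is not part of flatness; it is automatic for the forms below when built from a smooth function.\<close>

type_synonym one_form = "(plane \<Rightarrow> cmat2) \<times> (plane \<Rightarrow> cmat2)"

definition flat :: "one_form \<Rightarrow> bool" where
  "flat = (\<lambda>(A, B). \<forall>p. dt A p - dx B p = commutator (A p) (B p))"

text \<open>\<open>eqn q\<close> says that \<open>q\<close> solves the equation; \<open>\<tau> q \<mu>\<close> is the one-form at parameter \<open>\<mu>\<close> (the usual spectral parameter)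
  associated with \<open>q\<close>.\<close>

definition is_lax_pair ::
  "((plane \<Rightarrow> complex) \<Rightarrow> bool) \<Rightarrow> ((plane \<Rightarrow> complex) \<Rightarrow> complex \<Rightarrow> one_form) \<Rightarrow> bool" where
  "is_lax_pair eqn \<tau> \<longleftrightarrow> (\<forall>q. smooth q \<longrightarrow> (eqn q \<longleftrightarrow> (\<forall>\<mu>. flat (\<tau> q \<mu>))))"

text \<open>The form \<open>g \<theta> g\<^sup>-\<^sup>1 - (dg) g\<^sup>-\<^sup>1\<close>.\<close>

definition gauge :: "(plane \<Rightarrow> cmat2) \<Rightarrow> one_form \<Rightarrow> one_form" where
  "gauge g = (\<lambda>(A, B).
     (\<lambda>p. g p ** A p ** matrix_inv (g p) - dx g p ** matrix_inv (g p),
      \<lambda>p. g p ** B p ** matrix_inv (g p) - dt g p ** matrix_inv (g p)))"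

definition gauge_equivalent :: "(complex \<Rightarrow> one_form) \<Rightarrow> (complex \<Rightarrow> one_form) \<Rightarrow> bool" where
  "gauge_equivalent \<tau> \<theta> \<longleftrightarrow>
     (\<exists>g. smooth g \<and> range g \<subseteq> SU2 \<and> (\<forall>\<mu>. \<tau> \<mu> = gauge g (\<theta> \<mu>)))"

definition a_mat :: cmat2 where
  "a_mat = mat22 \<i> 0 0 (- \<i>)"

definition u_mat :: "(plane \<Rightarrow> complex) \<Rightarrow> plane \<Rightarrow> cmat2" where
  "u_mat q p = mat22 0 (q p) (- cnj (q p)) 0"

definition Qm1 :: "(plane \<Rightarrow> complex) \<Rightarrow> plane \<Rightarrow> cmat2" where
  "Qm1 q p = (\<i> / 2) *\<^sub>C
     mat22 (- of_real ((cmod (q p))\<^sup>2)) (dx q p)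
           (dx (\<lambda>r. cnj (q r)) p) (of_real ((cmod (q p))\<^sup>2))"

definition GP :: "real \<Rightarrow> (plane \<Rightarrow> complex) \<Rightarrow> bool" where
  "GP \<sigma> q \<longleftrightarrow> smooth q \<and>
     (\<forall>p. dt q p = \<i> / 2 * (dx (dx q) p + of_real \<sigma> * q p + 2 * of_real ((cmod (q p))\<^sup>2) * q p))"

definition NLS :: "(plane \<Rightarrow> complex) \<Rightarrow> bool" where
  "NLS v \<longleftrightarrow> smooth v \<and>
     (\<forall>p. dt v p = \<i> / 2 * (dx (dx v) p + 2 * of_real ((cmod (v p))\<^sup>2) * v p))"

definition lax_GP :: "real \<Rightarrow> (plane \<Rightarrow> complex) \<Rightarrow> complex \<Rightarrow> one_form" where
  "lax_GP \<sigma> q \<mu> =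
     (\<lambda>p. \<mu> *\<^sub>C a_mat + u_mat q p,
      \<lambda>p. \<mu>\<^sup>2 *\<^sub>C a_mat + \<mu> *\<^sub>C u_mat q p + Qm1 q p - of_real (\<sigma> / 4) *\<^sub>C a_mat)"

definition lax_NLS :: "(plane \<Rightarrow> complex) \<Rightarrow> complex \<Rightarrow> one_form" where
  "lax_NLS v \<mu> =
     (\<lambda>p. \<mu> *\<^sub>C a_mat + u_mat v p,
      \<lambda>p. \<mu>\<^sup>2 *\<^sub>C a_mat + \<mu> *\<^sub>C u_mat v p + Qm1 v p)"

end

theory Submission
  imports Defs
begin

text \<open>
  The form \<open>\<tau>\<close> contains \<open>\<sigma>\<close> only through the constant diagonal term \<open>- (\<sigma>/4) a\<close> of its
  \<open>dt\<close>-part. This term is what a rotation of the phase at constant speed in \<open>t\<close> produces, and all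
  three claims express this in different ways.

  Flatness. In \<open>A\<^sub>t - B\<^sub>x - [A, B]\<close> the coefficients of the powers of \<open>\<lambda>\<close> vanish identically,
  except for the coefficient of \<open>\<lambda>\<^sup>0\<close>: the \<open>\<lambda>\<^sup>2\<close>-terms cancel because \<open>[a, u] + [u, a] = 0\<close>, the
  \<open>\<lambda>\<close>-terms because the off-diagonal part of \<open>Q\<^sub>-\<^sub>1\<close> is chosen with \<open>[a, Q\<^sub>-\<^sub>1] = - u\<^sub>x\<close>, and the
  diagonal \<open>\<lambda>\<^sup>0\<close>-terms because the diagonal of \<open>Q\<^sub>-\<^sub>1\<close> is a primitive of that of \<open>- [u, Q\<^sub>-\<^sub>1]\<close>.
  The two remaining entries are the equation and its negative conjugate. So already flatness for a
  single \<open>\<lambda>\<close> is equivalent to the equation (\<open>flat_lax_GP_iff\<close>, where the parameter is \<open>\<mu>\<close>).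

  Gauge. The diagonal matrix \<open>g = diag(e\<^bsup>i\<sigma>t/4\<^esup>, e\<^bsup>-i\<sigma>t/4\<^esup>)\<close> commutes with \<open>a\<close>, its
  conjugation multiplies the upper right entries by \<open>e\<^bsup>i\<sigma>t/2\<^esup>\<close> and the lower left ones by the
  conjugate, and \<open>- g\<^sub>t g\<^sup>-\<^sup>1 = - (\<sigma>/4) a\<close>. Hence it maps the focusing NLS form of
  \<open>v = e\<^bsup>-i\<sigma>t/2\<^esup> q\<close> to \<open>\<tau>\<close> (\<open>gauge_equivalent_phase_rotation\<close>).

  Solutions. The factor \<open>e\<^bsup>i\<sigma>t/2\<^esup>\<close> has modulus one and does not depend on \<open>x\<close>, so it commutes
  with every term of the NLS except \<open>\<partial>\<^sub>t\<close>, which yields the extra term \<open>(i/2) \<sigma> q\<close>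
  (\<open>NLS_imp_GP_phase_rotation\<close>).
\<close>

section \<open>Smooth functions\<close>

lemma Ck_Suc_imp_Ck: "Ck (Suc n) f \<Longrightarrow> Ck n f"
proof (induction n arbitrary: f)
  case 0
  then have "f differentiable (at p)" for p by simp
  then show ?case
    by (auto simp: continuous_on_eq_continuous_at intro: differentiable_imp_continuous_within)
next
  case (Suc n)
  from Suc.prems have "f differentiable (at p)" "Ck (Suc n) (\<lambda>p. frechet_derivative f (at p) h)"
    for p h unfolding Ck.simps(2)[of "Suc n"] by blast+
  with Suc.IH show ?case by simp
qed

lemma smooth_imp_differentiable: "smooth f \<Longrightarrow> f differentiable (at p)"
  using Ck.simps(2)[of 0 f] unfolding smooth_def by blast

lemma smooth_imp_has_derivative:
  "smooth f \<Longrightarrow> (f has_derivative frechet_derivative f (at p)) (at p)"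
  by (simp add: smooth_imp_differentiable flip: frechet_derivative_works)

lemma smooth_frechet_derivative: "smooth f \<Longrightarrow> smooth (\<lambda>p. frechet_derivative f (at p) h)"
  unfolding smooth_def using Ck.simps(2) by blast

text \<open>Smoothness of sums and products is proved from a derivative given by a differentiation rule
  rather than from the choice operator in \<open>frechet_derivative\<close>; the next two rules translate between
  the two.\<close>

lemma Ck_SucI:
  assumes "\<And>p. (f has_derivative f' p) (at p)" "\<And>h. Ck n (\<lambda>p. f' p h)"
  shows "Ck (Suc n) f"
proof -
  have "frechet_derivative f (at p) = f' p" for p
    by (rule frechet_derivative_at[OF assms(1), symmetric])
  then show ?thesis using assms by (auto simp: differentiable_def)
qed

lemma Ck_SucE:
  assumes "Ck (Suc n) f"
  obtains f' where "\<And>p. (f has_derivative f' p) (at p)" "\<And>h. Ck n (\<lambda>p. f' p h)"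
  using assms that[of "\<lambda>p. frechet_derivative f (at p)"]
  by (simp add: frechet_derivative_works)

lemma Ck_add: "Ck n f \<Longrightarrow> Ck n g \<Longrightarrow> Ck n (\<lambda>p. f p + g p)"
proof (induction n arbitrary: f g)
  case 0
  then show ?case by (simp add: continuous_on_add)
next
  case (Suc n)
  obtain f' where f': "\<And>p. (f has_derivative f' p) (at p)" "\<And>h. Ck n (\<lambda>p. f' p h)"
    by (rule Ck_SucE[OF Suc.prems(1)]) blast
  obtain g' where g': "\<And>p. (g has_derivative g' p) (at p)" "\<And>h. Ck n (\<lambda>p. g' p h)"
    by (rule Ck_SucE[OF Suc.prems(2)]) blast
  show ?case
    by (rule Ck_SucI[OF has_derivative_add[OF f'(1) g'(1)]]) (intro Suc.IH f' g')
qed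

lemma Ck_mult:
  fixes f g :: "'a::euclidean_space \<Rightarrow> 'b::real_normed_algebra"
  shows "Ck n f \<Longrightarrow> Ck n g \<Longrightarrow> Ck n (\<lambda>p. f p * g p)"
proof (induction n arbitrary: f g)
  case 0
  then show ?case by (simp add: continuous_on_mult)
next
  case (Suc n)
  obtain f' where f': "\<And>p. (f has_derivative f' p) (at p)" "\<And>h. Ck n (\<lambda>p. f' p h)"
    by (rule Ck_SucE[OF Suc.prems(1)]) blast
  obtain g' where g': "\<And>p. (g has_derivative g' p) (at p)" "\<And>h. Ck n (\<lambda>p. g' p h)"
    by (rule Ck_SucE[OF Suc.prems(2)]) blast
  show ?case
    \<comment> \<open>The product rule leaves one factor undifferentiated; being \<open>C\<^sup>n\<^sup>+\<^sup>1\<close>, it is \<open>C\<^sup>n\<close>.\<close>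
    by (rule Ck_SucI[OF has_derivative_mult[OF f'(1) g'(1)]])
      (intro Ck_add Suc.IH f' g' Suc.prems[THEN Ck_Suc_imp_Ck])
qed

lemma smooth_mult:
  fixes f g :: "'a::euclidean_space \<Rightarrow> 'b::real_normed_algebra"
  shows "smooth f \<Longrightarrow> smooth g \<Longrightarrow> smooth (\<lambda>p. f p * g p)"
  by (simp add: smooth_def Ck_mult)

lemma Ck_bounded_linear:
  assumes "bounded_linear L"
  shows "Ck n f \<Longrightarrow> Ck n (\<lambda>p. L (f p))"
proof (induction n arbitrary: f)
  case 0
  then show ?case by (simp add: bounded_linear.continuous_on[OF assms])
next
  case (Suc n)
  obtain f' where f': "\<And>p. (f has_derivative f' p) (at p)" "\<And>h. Ck n (\<lambda>p. f' p h)"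
    by (rule Ck_SucE[OF Suc.prems]) blast
  show ?case
    by (rule Ck_SucI[OF bounded_linear.has_derivative[OF assms f'(1)]]) (intro Suc.IH f')
qed

lemma smooth_bounded_linear: "bounded_linear L \<Longrightarrow> smooth f \<Longrightarrow> smooth (\<lambda>p. L (f p))"
  by (simp add: smooth_def Ck_bounded_linear)

lemma has_vector_derivative_exp_of_real:
  fixes c :: complex
  shows "((\<lambda>t. exp (c * of_real t)) has_vector_derivative c * exp (c * of_real t)) (at t)"
  by (rule has_vector_derivative_real_field) (auto intro!: derivative_eq_intros)

text \<open>The differential of \<open>e\<^bsup>ct\<^esup>\<close> in a fixed direction is a constant multiple of \<open>e\<^bsup>ct\<^esup>\<close>, so the
  induction on the order of differentiability closes on this one function.\<close>

lemma smooth_exp_snd: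
  fixes c :: complex
  shows "smooth (\<lambda>p::plane. exp (c * of_real (snd p)))"
  unfolding smooth_def
proof
  fix n
  let ?e = "\<lambda>p::plane. exp (c * of_real (snd p))"
  have deriv: "(?e has_derivative (\<lambda>h. c * of_real (snd h) * ?e p)) (at p)" for p
    using has_derivative_compose[OF has_derivative_snd[OF has_derivative_ident]
        has_vector_derivative_exp_of_real[unfolded has_vector_derivative_def]]
    by (simp add: scaleR_conv_of_real algebra_simps)
  show "Ck n ?e"
  proof (induction n)
    case 0
    show ?case by (auto intro!: continuous_intros)
  next
    case (Suc n)
    show ?case
      by (rule Ck_SucI[OF deriv]) (rule Ck_bounded_linear[OF bounded_linear_mult_right Suc])
  qed
qed

section \<open>Partial derivatives\<close>

lemma dx_eqI: "((\<lambda>s. f (s, t)) has_vector_derivative D) (at x) \<Longrightarrow> dx f (x, t) = D"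
  by (simp add: dx_def vector_derivative_at)

lemma dt_eqI: "((\<lambda>s. f (x, s)) has_vector_derivative D) (at t) \<Longrightarrow> dt f (x, t) = D"
  by (simp add: dt_def vector_derivative_at)

lemma smooth_has_partial_x_frechet:
  assumes "smooth f"
  shows "((\<lambda>s. f (s, t)) has_vector_derivative frechet_derivative f (at (x, t)) (1, 0)) (at x)"
proof -
  have "((\<lambda>s. (s, t)) has_vector_derivative (1, 0)) (at x)"
    by (intro has_vector_derivative_Pair derivative_intros)
  from vector_derivative_diff_chain_within[OF this
      has_derivative_at_withinI[OF smooth_imp_has_derivative[OF assms]]]
  show ?thesis by (simp add: o_def)
qed

lemma smooth_has_partial_t_frechet:
  assumes "smooth f"
  shows "((\<lambda>s. f (x, s)) has_vector_derivative frechet_derivative f (at (x, t)) (0, 1)) (at t)"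
proof -
  have "((\<lambda>s. (x, s)) has_vector_derivative (0, 1)) (at t)"
    by (intro has_vector_derivative_Pair derivative_intros)
  from vector_derivative_diff_chain_within[OF this
      has_derivative_at_withinI[OF smooth_imp_has_derivative[OF assms]]]
  show ?thesis by (simp add: o_def)
qed

lemma smooth_has_partial_x:
  "smooth f \<Longrightarrow> ((\<lambda>s. f (s, t)) has_vector_derivative dx f (x, t)) (at x)"
  using dx_eqI smooth_has_partial_x_frechet by metis

lemma smooth_has_partial_t:
  "smooth f \<Longrightarrow> ((\<lambda>s. f (x, s)) has_vector_derivative dt f (x, t)) (at t)"
  using dt_eqI smooth_has_partial_t_frechet by metis

lemma smooth_dx:
  assumes "smooth f"
  shows "smooth (dx f)"
proof -
  have "dx f = (\<lambda>p. frechet_derivative f (at p) (1, 0))"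
    by (auto intro!: dx_eqI smooth_has_partial_x_frechet assms)
  then show ?thesis by (simp add: smooth_frechet_derivative assms)
qed

lemma dx_cnj: "smooth q \<Longrightarrow> dx (\<lambda>r. cnj (q r)) p = cnj (dx q p)"
  by (cases p) (auto intro!: dx_eqI has_vector_derivative_cnj smooth_has_partial_x)

section \<open>Two-by-two matrices in entries\<close>

lemma mat22_nth [simp]:
  "mat22 p q r s $ 1 $ 1 = p" "mat22 p q r s $ 1 $ 2 = q"
  "mat22 p q r s $ 2 $ 1 = r" "mat22 p q r s $ 2 $ 2 = s"
  by (simp_all add: mat22_def)

lemma mat22_eq_iff: "mat22 p q r s = mat22 p' q' r' s' \<longleftrightarrow> p = p' \<and> q = q' \<and> r = r' \<and> s = s'"
  by (auto simp: vec_eq_iff forall_2)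

lemma mat22_add: "mat22 p q r s + mat22 p' q' r' s' = mat22 (p + p') (q + q') (r + r') (s + s')"
  by (simp add: vec_eq_iff forall_2)

lemma mat22_diff: "mat22 p q r s - mat22 p' q' r' s' = mat22 (p - p') (q - q') (r - r') (s - s')"
  by (simp add: vec_eq_iff forall_2)

lemma mat22_mult:
  "mat22 p q r s ** mat22 p' q' r' s' =
    mat22 (p * p' + q * r') (p * q' + q * s') (r * p' + s * r') (r * q' + s * s')"
  by (simp add: vec_eq_iff forall_2 matrix_matrix_mult_def sum_2)

lemma mat22_cscale: "c *\<^sub>C mat22 p q r s = mat22 (c * p) (c * q) (c * r) (c * s)"
  by (simp add: vec_eq_iff forall_2 cscale_def map_matrix_def)

lemma mat22_one: "mat 1 = mat22 1 0 0 1"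
  by (simp add: vec_eq_iff forall_2 mat_def)

lemma mat22_adjoint:
  "map_matrix cnj (transpose (mat22 p q r s)) = mat22 (cnj p) (cnj r) (cnj q) (cnj s)"
  by (simp add: vec_eq_iff forall_2 map_matrix_def transpose_def)

lemmas mat22_simps = mat22_add mat22_diff mat22_mult mat22_cscale mat22_eq_iff

lemma bounded_linear_mat22: "bounded_linear (\<lambda>(p, q, r, s). mat22 p q r s)"
  by (auto simp: linear_conv_bounded_linear[symmetric] linear_iff vec_eq_iff forall_2)

lemma has_vector_derivative_mat22:
  assumes "(p has_vector_derivative p') (at x within S)" "(q has_vector_derivative q') (at x within S)"
    "(r has_vector_derivative r') (at x within S)" "(s has_vector_derivative s') (at x within S)"
  shows "((\<lambda>y. mat22 (p y) (q y) (r y) (s y)) has_vector_derivative mat22 p' q' r' s')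
    (at x within S)"
  using bounded_linear.has_vector_derivative[OF bounded_linear_mat22
      has_vector_derivative_Pair[OF assms(1) has_vector_derivative_Pair[OF assms(2)
      has_vector_derivative_Pair[OF assms(3,4)]]]]
  by simp

section \<open>Flatness and the equation\<close>

lemma Qm1_eq_mat22:
  assumes "smooth q"
  shows "Qm1 q p = mat22 (- (\<i> / 2) * (q p * cnj (q p))) (\<i> / 2 * dx q p)
    (\<i> / 2 * cnj (dx q p)) (\<i> / 2 * (q p * cnj (q p)))"
  unfolding Qm1_def dx_cnj[OF assms] complex_norm_square mat22_cscale by simp

lemma lax_GP_eq_mat22:
  assumes "smooth q"
  shows "lax_GP \<sigma> q \<mu> =
    (\<lambda>p. mat22 (\<mu> * \<i>) (q p) (- cnj (q p)) (- \<mu> * \<i>),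
     \<lambda>p. mat22 (\<mu>\<^sup>2 * \<i> - \<i> / 2 * (q p * cnj (q p)) - of_real (\<sigma> / 4) * \<i>)
        (\<mu> * q p + \<i> / 2 * dx q p)
        (- \<mu> * cnj (q p) + \<i> / 2 * cnj (dx q p))
        (- (\<mu>\<^sup>2) * \<i> + \<i> / 2 * (q p * cnj (q p)) + of_real (\<sigma> / 4) * \<i>))"
  by (auto simp: lax_GP_def Qm1_eq_mat22[OF assms] a_mat_def u_mat_def mat22_simps)

lemma lax_NLS_eq_lax_GP: "lax_NLS = lax_GP 0"
  by (simp add: fun_eq_iff lax_NLS_def lax_GP_def a_mat_def mat22_cscale)
    (simp add: vec_eq_iff forall_2)

text \<open>The powers of \<open>\<mu>\<close> cancel in the curvature, so the equation is the same for every \<open>\<mu>\<close>. The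
  \<open>x\<close>-derivative of \<open>Q\<^sub>-\<^sub>1\<close> contributes \<open>q\<^sub>x\<^sub>x\<close>, the commutator of \<open>u\<close> with its diagonal contributes the
  cubic term, and the commutator of \<open>u\<close> with \<open>- (\<sigma>/4) a\<close> contributes the linear term.\<close>

lemma flat_lax_GP_iff:
  assumes q: "smooth q"
  shows "flat (lax_GP \<sigma> q \<mu>) \<longleftrightarrow> GP \<sigma> q"
proof -
  define A where "A = fst (lax_GP \<sigma> q \<mu>)"
  define B where "B = snd (lax_GP \<sigma> q \<mu>)"
  note AB_eq = A_def[unfolded lax_GP_eq_mat22[OF q] fst_conv]
    B_def[unfolded lax_GP_eq_mat22[OF q] snd_conv]
  have dtA: "dt A p = mat22 0 (dt q p) (- cnj (dt q p)) 0" for p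
    unfolding AB_eq by (cases p)
      (auto intro!: dt_eqI has_vector_derivative_mat22 derivative_intros
        smooth_has_partial_t q)
  \<comment> \<open>\<open>N\<close> is the \<open>x\<close>-derivative of \<open>(i/2) |q|\<^sup>2\<close>, written without the modulus.\<close>
  define N where "N p = \<i> / 2 * (dx q p * cnj (q p) + q p * cnj (dx q p))" for p
  have dxB: "dx B p = mat22 (- N p) (\<mu> * dx q p + \<i> / 2 * dx (dx q) p)
      (- \<mu> * cnj (dx q p) + \<i> / 2 * cnj (dx (dx q) p)) (N p)" for p
  proof (cases p)
    case (Pair x t)
    note [derivative_intros] = smooth_has_partial_x[OF q] smooth_has_partial_x[OF smooth_dx[OF q]]
    show ?thesis
      unfolding AB_eq Pair
      by (intro dx_eqI has_vector_derivative_mat22)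
        (auto intro!: derivative_eq_intros simp: N_def algebra_simps)
  qed
  define E where "E p = dt q p -
    \<i> / 2 * (dx (dx q) p + of_real \<sigma> * q p + 2 * of_real ((cmod (q p))\<^sup>2) * q p)" for p
  have curvature: "dt A p - dx B p - commutator (A p) (B p) = mat22 0 (E p) (- cnj (E p)) 0" for p
    unfolding dtA dxB
    unfolding AB_eq commutator_def mat22_simps E_def complex_norm_square N_def
    by (simp add: field_simps power2_eq_square)
  have "dt A p - dx B p = commutator (A p) (B p) \<longleftrightarrow> E p = 0" for p
    unfolding right_minus_eq[symmetric, of "dt A p - dx B p"] curvature
    by (simp add: vec_eq_iff forall_2)
  then have "flat (A, B) \<longleftrightarrow> (\<forall>p. E p = 0)" by (simp add: flat_def)
  then show ?thesis by (simp add: A_def B_def GP_def q E_def)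
qed

lemma lax_pair_GP: "is_lax_pair (GP \<sigma>) (lax_GP \<sigma>)"
  by (simp add: is_lax_pair_def flat_lax_GP_iff)

section \<open>Rotating the phase\<close>

text \<open>The parametrisation of the diagonal torus of \<open>SU(2)\<close> by its upper left entry.\<close>

definition torus_mat :: "complex \<Rightarrow> cmat2" where
  "torus_mat z = mat22 z 0 0 (cnj z)"

lemma bounded_linear_torus_mat: "bounded_linear torus_mat"
  by (auto simp: linear_conv_bounded_linear[symmetric] linear_iff vec_eq_iff forall_2 torus_mat_def)

lemma torus_mat_mult: "torus_mat z ** torus_mat w = torus_mat (z * w)"
  by (simp add: torus_mat_def mat22_mult)

lemma torus_mat_one: "torus_mat 1 = mat 1"
  by (simp add: torus_mat_def mat22_one)

lemma mult_cnj_unit: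
  assumes "cmod z = 1"
  shows "z * cnj z = 1" "cnj z * z = 1"
proof -
  show "z * cnj z = 1"
    using complex_norm_square[of z] assms by simp
  then show "cnj z * z = 1"
    by (simp only: mult.commute)
qed

lemma torus_mat_SU2:
  assumes "cmod z = 1"
  shows "torus_mat z \<in> SU2"
proof -
  have "map_matrix cnj (transpose (torus_mat z)) = torus_mat (cnj z)"
    by (simp add: torus_mat_def mat22_adjoint)
  moreover have "det (torus_mat z) = 1"
    by (simp add: torus_mat_def det_2 mult_cnj_unit assms)
  ultimately show ?thesis
    by (simp add: SU2_def torus_mat_mult torus_mat_one mult_cnj_unit assms)
qed

lemma torus_mat_conjugation:
  assumes "cmod z = 1"
  shows "torus_mat z ** mat22 p q r s ** torus_mat (cnj z) = mat22 p (z\<^sup>2 * q) ((cnj z)\<^sup>2 * r) s"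
proof -
  have "torus_mat z ** mat22 p q r s ** torus_mat (cnj z) =
      mat22 (z * cnj z * p) (z\<^sup>2 * q) ((cnj z)\<^sup>2 * r) (z * cnj z * s)"
    by (simp add: torus_mat_def mat22_mult mat22_eq_iff power2_eq_square)
  then show ?thesis
    by (simp only: mult_cnj_unit[OF assms] mult_1)
qed

lemma matrix_inv_eqI:
  fixes A B :: "'a::semiring_1^'n^'n"
  assumes "A ** B = mat 1" "B ** A = mat 1"
  shows "matrix_inv A = B"
proof -
  have inv: "A ** matrix_inv A = mat 1 \<and> matrix_inv A ** A = mat 1"
    unfolding matrix_inv_def by (rule someI[of _ B]) (simp add: assms)
  have "matrix_inv A = (B ** A) ** matrix_inv A"
    by (simp only: assms matrix_mul_lid)
  also have "\<dots> = B ** (A ** matrix_inv A)"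
    by (rule matrix_mul_assoc[symmetric])
  also have "\<dots> = B"
    by (simp only: inv matrix_mul_rid)
  finally show ?thesis .
qed

lemma matrix_inv_torus_mat:
  assumes "cmod z = 1"
  shows "matrix_inv (torus_mat z) = torus_mat (cnj z)"
  by (rule matrix_inv_eqI) (simp_all only: torus_mat_mult mult_cnj_unit[OF assms] torus_mat_one)

text \<open>The gauge carries half of the phase difference: conjugation by \<open>diag(z, 1/z)\<close> multiplies the
  off-diagonal entries by \<open>z\<^sup>2\<close> and \<open>1/z\<^sup>2\<close>, so \<open>z = e\<^bsup>i\<sigma>t/4\<^esup>\<close> undoes the factor \<open>e\<^bsup>-i\<sigma>t/2\<^esup>\<close> in
  \<open>v\<close>. The same \<open>z\<close> gives \<open>z\<^sub>t / z = i\<sigma>/4\<close>, the coefficient in \<open>- (\<sigma>/4) a\<close>.\<close>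

lemma gauge_equivalent_phase_rotation:
  assumes q: "smooth q"
    and v_def: "v = (\<lambda>(x, t). exp (- of_real \<sigma> * \<i> / 2 * of_real t) * q (x, t))"
  shows "gauge_equivalent (lax_GP \<sigma> q) (lax_NLS v)"
proof -
  define z where "z p = exp (of_real \<sigma> * \<i> / 4 * of_real (snd p))" for p :: plane
  have cnj_z: "cnj (z p) = exp (- of_real \<sigma> * \<i> / 4 * of_real (snd p))" for p
    by (simp add: z_def exp_cnj)
  have v: "v p = (cnj (z p))\<^sup>2 * q p" for p
    by (cases p) (simp add: v_def cnj_z power2_eq_square mult_ac flip: exp_add)
  have norm_z: "cmod (z p) = 1" for p
    by (simp add: z_def)
  have square_z: "(z p)\<^sup>2 * (cnj (z p))\<^sup>2 = 1" for p
    using mult_cnj_unit[OF norm_z] by (simp flip: power_mult_distrib)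
  have smooth_z: "smooth z"
    unfolding z_def by (rule smooth_exp_snd)
  have "smooth (\<lambda>p. cnj (z p))"
    unfolding cnj_z by (rule smooth_exp_snd)
  then have smooth_v: "smooth v"
    unfolding v power2_eq_square by (intro smooth_mult q)
  have dx_v: "dx v p = (cnj (z p))\<^sup>2 * dx q p" for p
  proof (cases p)
    case (Pair x t)
    have "(\<lambda>s. v (s, t)) = (\<lambda>s. (cnj (z (x, t)))\<^sup>2 * q (s, t))"
      by (simp add: v z_def)
    then show ?thesis
      unfolding Pair
      by (intro dx_eqI) (auto intro!: has_vector_derivative_mult_right smooth_has_partial_x q)
  qed
  have dx_g: "dx (\<lambda>p. torus_mat (z p)) p = 0" for p
    by (cases p) (auto intro!: dx_eqI simp: z_def)
  have dt_g: "dt (\<lambda>p. torus_mat (z p)) p = torus_mat (of_real \<sigma> * \<i> / 4) ** torus_mat (z p)" for p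
  proof (cases p)
    case (Pair x t)
    have "((\<lambda>s. z (x, s)) has_vector_derivative of_real \<sigma> * \<i> / 4 * z (x, t)) (at t)"
      unfolding z_def snd_conv by (rule has_vector_derivative_exp_of_real)
    then show ?thesis
      unfolding Pair torus_mat_mult
      by (intro dt_eqI bounded_linear.has_vector_derivative[OF bounded_linear_torus_mat])
  qed
  have q_v: "q p = (z p)\<^sup>2 * v p" for p
    by (simp only: v square_z mult_1 flip: mult.assoc)
  have dx_q_v: "dx q p = (z p)\<^sup>2 * dx v p" for p
    by (simp only: dx_v square_z mult_1 flip: mult.assoc)
  have modulus: "q p * cnj (q p) = v p * cnj (v p)" for p
  proof -
    have "cmod (q p) = cmod (v p)"
      by (simp add: v norm_mult norm_power norm_z)
    then show ?thesis
      unfolding complex_norm_square[symmetric] by simp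
  qed
  \<comment> \<open>For \<open>c = i\<sigma>/4\<close> the left-hand side is \<open>g\<^sub>t g\<^sup>-\<^sup>1\<close>.\<close>
  have log_deriv: "torus_mat c ** torus_mat (z p) ** torus_mat (cnj (z p)) = torus_mat c" for c p
    by (simp add: torus_mat_mult mult_cnj_unit norm_z mult.assoc)
  have "lax_GP \<sigma> q \<mu> = gauge (\<lambda>p. torus_mat (z p)) (lax_NLS v \<mu>)" for \<mu>
    unfolding lax_NLS_eq_lax_GP lax_GP_eq_mat22[OF q] lax_GP_eq_mat22[OF smooth_v] gauge_def split_conv
      modulus matrix_inv_torus_mat[OF norm_z] dx_g dt_g torus_mat_conjugation[OF norm_z] log_deriv
    unfolding q_v dx_q_v torus_mat_def
    by (simp add: mat22_simps ring_distribs mult.left_commute)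
  moreover have "smooth (\<lambda>p. torus_mat (z p))"
    by (rule smooth_bounded_linear[OF bounded_linear_torus_mat smooth_z])
  ultimately show ?thesis
    unfolding gauge_equivalent_def using torus_mat_SU2[OF norm_z] by blast
qed

lemma NLS_imp_GP_phase_rotation:
  assumes v: "NLS v"
    and q_def: "q = (\<lambda>(x, t). exp (of_real \<sigma> * \<i> / 2 * of_real t) * v (x, t))"
  shows "GP \<sigma> q"
proof -
  from v have smooth_v: "smooth v"
    and nls: "dt v p = \<i> / 2 * (dx (dx v) p + 2 * of_real ((cmod (v p))\<^sup>2) * v p)" for p
    unfolding NLS_def by blast+
  define e where "e t = exp (of_real \<sigma> * \<i> / 2 * of_real t)" for t :: real
  have q: "q = (\<lambda>p. e (snd p) * v p)"
    by (auto simp: q_def e_def)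
  have dx_rotated: "dx (\<lambda>p. e (snd p) * f p) = (\<lambda>p. e (snd p) * dx f p)"
    if "smooth f" for f :: "plane \<Rightarrow> complex"
    by (auto intro!: dx_eqI has_vector_derivative_mult_right smooth_has_partial_x that)
  have smooth_q: "smooth q"
    unfolding q e_def by (intro smooth_mult smooth_exp_snd smooth_v)
  have dxx_q: "dx (dx q) p = e (snd p) * dx (dx v) p" for p
    by (simp add: q dx_rotated smooth_v smooth_dx)
  have e_deriv: "(e has_vector_derivative of_real \<sigma> * \<i> / 2 * e t) (at t)" for t
    unfolding e_def by (rule has_vector_derivative_exp_of_real)
  have "dt q (x, t) = e t * dt v (x, t) + of_real \<sigma> * \<i> / 2 * e t * v (x, t)" for x t
    unfolding q
    using has_vector_derivative_mult[OF e_deriv smooth_has_partial_t[OF smooth_v]]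
    by (intro dt_eqI) simp
  then have dt_q: "dt q p = e (snd p) * dt v p + of_real \<sigma> * \<i> / 2 * e (snd p) * v p" for p
    by (cases p) simp
  have norm_q: "cmod (q p) = cmod (v p)" for p
    by (simp add: q e_def norm_mult)
  show ?thesis
    unfolding GP_def
  proof (intro conjI allI smooth_q)
    fix p
    show "dt q p =
      \<i> / 2 * (dx (dx q) p + of_real \<sigma> * q p + 2 * of_real ((cmod (q p))\<^sup>2) * q p)"
      unfolding dt_q dxx_q norm_q nls
      by (simp only: q) (simp add: ring_distribs mult_ac)
  qed
qed

theorem proposition4p1:
  fixes \<sigma> :: real
  assumes "\<sigma> \<in> {1, -1}"
  shows "is_lax_pair (GP \<sigma>) (lax_GP \<sigma>)
    \<and> (\<forall>q v. GP \<sigma> q \<and> v = (\<lambda>(x, t). exp (- of_real \<sigma> * \<i> / 2 * of_real t) * q (x, t))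
         \<longrightarrow> gauge_equivalent (lax_GP \<sigma> q) (lax_NLS v))
    \<and> (\<forall>v q. NLS v \<and> q = (\<lambda>(x, t). exp (of_real \<sigma> * \<i> / 2 * of_real t) * v (x, t))
         \<longrightarrow> GP \<sigma> q)"
proof (intro conjI allI impI; (elim conjE)?)
  show "is_lax_pair (GP \<sigma>) (lax_GP \<sigma>)"
    by (rule lax_pair_GP)
next
  fix q v
  assume "GP \<sigma> q" "v = (\<lambda>(x, t). exp (- of_real \<sigma> * \<i> / 2 * of_real t) * q (x, t))"
  then show "gauge_equivalent (lax_GP \<sigma> q) (lax_NLS v)"
    by (intro gauge_equivalent_phase_rotation) (simp_all add: GP_def)
next
  fix v q
  assume "NLS v" "q = (\<lambda>(x, t). exp (of_real \<sigma> * \<i> / 2 * of_real t) * v (x, t))"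
  then show "GP \<sigma> q"
    by (rule NLS_imp_GP_phase_rotation)
qed

end
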